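(* Let $A$ be a real symmetric matrix of order $n$, let $k\ge 2$, and let $\mathcal{V}=\{V_1,\dots,V_k\}$ be a partition of $[n]=\{1,\dots,n\}$. If $B$ is a real diagonal matrix of order $n$, then $$\lambda_1(B-A)\ \ge\ \frac{2k}{(k-1)n}\,\mathrm{cut}(A,\mathcal{V})-\frac{1}{n}\Sigma A+\frac{1}{n}\Sigma B.$$
   Context: For a matrix $M$, $\Sigma M$ denotes the sum of all its entries, and $\lambda_1(M)$ denotes the largest eigenvalue of a symmetric matrix $M$. For an $n\times n$ matrix $A$ and a partition $\mathcal{V}=\{V_1,\dots,V_k\}$ of $[n]$, $A_{p,q}$ is the submatrix of $A$ consisting of the entries $a_{i,j}$ with $i\in V_p$, $j\in V_q$, and $\mathrm{cut}(A,\mathcal{V})$ is defined by $2\,\mathrm{cut}(A,\mathcal{V})=\Sigma A-\Sigma A_{1,1}-\cdots-\Sigma A_{k,k}$. *)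

theory Defs
  imports
    "Jordan_Normal_Form.Spectral_Radius"
    "Jordan_Normal_Form.DL_Submatrix"
    "HOL-Library.Disjoint_Sets"
begin

text \<open>
  Matrices of order n are elements of \<^term>\<open>carrier_mat n n\<close>. The library
  indexes rows and columns from 0, so the index set [n] is \<^term>\<open>{0..<n}\<close>.
\<close>

text \<open>
  For a real matrix, \<^const>\<open>spectrum\<close> is the set of its real eigenvalues; for a symmetric
  matrix of order at least 1 it is finite and nonempty, so that the maximum exists.
\<close>

definition lambda1 :: "real mat \<Rightarrow> real" where
  "lambda1 M = Max (spectrum M)"

definition mat_cut :: "real mat \<Rightarrow> nat set set \<Rightarrow> real" where
  "mat_cut A \<V> = (sum_mat A - (\<Sum>V\<in>\<V>. sum_mat (submatrix A V V))) / 2"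

end

theory Submission
  imports Defs "HOL-Analysis.Function_Topology"
begin

text \<open>
  By the Rayleigh principle, \<open>\<lambda>\<^sub>1(M)\<close> bounds \<open>x\<^sup>T M x / x\<^sup>T x\<close> from above for every \<open>x \<noteq> 0\<close>.
  For each class \<open>V\<close> take the test vector that is \<open>1 - k\<close> on \<open>V\<close> and \<open>1\<close> elsewhere.
  Summing over the \<open>k\<close> classes, the products \<open>x\<^sub>i x\<^sub>j\<close> add up to \<open>k (k - 1)\<close> if \<open>i\<close> and \<open>j\<close>
  lie in the same class and to \<open>- k\<close> otherwise, and for \<open>M = B - A\<close> the sum of the
  Rayleigh inequalities is the claim.
\<close>

section \<open>The Rayleigh principle, by maximising the quadratic form on the unit sphere\<close>

lemma linear_coeff_zero_if_quadratic_nonneg: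
  fixes s c :: real
  assumes nonneg: "\<And>t. 2 * t * s + t\<^sup>2 * c \<ge> 0"
  shows "s = 0"
proof -
  \<comment> \<open>For \<open>c > 0\<close> the minimum is at \<open>t = - s / c\<close>. With
    \<open>\<bar>c\<bar> + 1\<close> in place of \<open>c\<close> the denominator is positive
    whatever the sign of \<open>c\<close>, and the value is still negative unless
    \<open>s = 0\<close>.\<close>
  have "2 * (- s / (\<bar>c\<bar> + 1)) * s + (- s / (\<bar>c\<bar> + 1))\<^sup>2 * c
      = s\<^sup>2 * (c - 2 * (\<bar>c\<bar> + 1)) / (\<bar>c\<bar> + 1)\<^sup>2"
    by (simp add: divide_simps) (simp add: algebra_simps power2_eq_square)
  with nonneg[of "- s / (\<bar>c\<bar> + 1)"]
  have "0 \<le> s\<^sup>2 * (c - 2 * (\<bar>c\<bar> + 1)) / (\<bar>c\<bar> + 1)\<^sup>2"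
    by simp
  moreover have "(\<bar>c\<bar> + 1)\<^sup>2 > 0" by (simp add: add_nonneg_eq_0_iff)
  ultimately have "0 \<le> s\<^sup>2 * (c - 2 * (\<bar>c\<bar> + 1))"
    by (simp add: zero_le_divide_iff)
  moreover have "c - 2 * (\<bar>c\<bar> + 1) < 0"
    using abs_ge_self[of c] abs_ge_zero[of c] by argo
  ultimately show ?thesis
    by (smt (verit) mult_pos_neg zero_less_power2)
qed

text \<open>Vectors are functions on the naturals in the product topology. Since the coordinates
  from \<open>n\<close> on vanish, the sphere is a closed subset of the cube with all sides [-1,1],
  which is compact by Tychonoff.\<close>

lemma compact_unit_sphere_coords:
  fixes n :: nat
  shows "compact {x :: nat \<Rightarrow> real. (\<forall>i\<ge>n. x i = 0) \<and> (\<Sum>i<n. (x i)\<^sup>2) = 1}" (is "compact ?S")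
proof -
  have "compactin (product_topology (\<lambda>_::nat. euclideanreal) UNIV) (\<Pi>\<^sub>E i\<in>UNIV. {-1..1})"
    by (simp add: compactin_PiE)
  then have K: "compact (\<Pi>\<^sub>E i\<in>(UNIV::nat set). {-1..1::real})"
    by (simp add: euclidean_product_topology)
  have "closed {x :: nat \<Rightarrow> real. x i = 0}" for i
    by (intro closed_Collect_eq continuous_intros) simp
  then have "closed (\<Inter>i\<in>{n..}. {x :: nat \<Rightarrow> real. x i = 0})"
    by blast
  moreover have "closed {x :: nat \<Rightarrow> real. (\<Sum>i<n. (x i)\<^sup>2) = 1}"
    by (intro closed_Collect_eq continuous_intros) simp
  ultimately have
    C: "closed ((\<Inter>i\<in>{n..}. {x :: nat \<Rightarrow> real. x i = 0}) \<inter> {x. (\<Sum>i<n. (x i)\<^sup>2) = 1})"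
    by (rule closed_Int)
  have "\<bar>x i\<bar> \<le> 1" if "x \<in> ?S" for x :: "nat \<Rightarrow> real" and i
  proof (cases "i < n")
    case True
    then have "(x i)\<^sup>2 \<le> (\<Sum>i<n. (x i)\<^sup>2)"
      by (intro member_le_sum) auto
    with that show ?thesis by (simp add: abs_square_le_1)
  qed (use that in auto)
  then have "?S = (\<Pi>\<^sub>E i\<in>UNIV. {-1..1}) \<inter>
      ((\<Inter>i\<in>{n..}. {x. x i = 0}) \<inter> {x. (\<Sum>i<n. (x i)\<^sup>2) = 1})"
    by (fastforce simp: abs_le_iff PiE_def Pi_def)
  with compact_Int_closed[OF K C] show ?thesis by simp
qed

text \<open>A maximiser of the form on the unit sphere is an eigenvector by first-order optimality,
  and its eigenvalue is the maximum; homogeneity extends the bound from the sphere to all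
  \<open>y\<close>.\<close>

lemma quadratic_form_maximum_eigenvector:
  fixes a :: "nat \<Rightarrow> nat \<Rightarrow> real"
  assumes n: "n > 0" and sym: "\<And>i j. i < n \<Longrightarrow> j < n \<Longrightarrow> a i j = a j i"
  obtains l x i where "i < n" "x i \<noteq> 0"
    and "\<And>i. i < n \<Longrightarrow> (\<Sum>j<n. a i j * x j) = l * x i"
    and "\<And>y. (\<Sum>i<n. \<Sum>j<n. a i j * y i * y j) \<le> l * (\<Sum>i<n. (y i)\<^sup>2)"
proof -
  define S where "S = {x :: nat \<Rightarrow> real. (\<forall>i\<ge>n. x i = 0) \<and> (\<Sum>i<n. (x i)\<^sup>2) = 1}"
  define q where "q = (\<lambda>y. \<Sum>i<n. \<Sum>j<n. a i j * y i * y j)"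
  define nn where "nn = (\<lambda>y :: nat \<Rightarrow> real. \<Sum>i<n. (y i)\<^sup>2)"
  have "compact S" unfolding S_def by (rule compact_unit_sphere_coords)
  moreover have "(\<lambda>i. if i = 0 then 1 else 0) \<in> S"
    using n by (simp add: S_def if_distrib[of "\<lambda>u. u\<^sup>2"] cong: if_cong)
  then have "S \<noteq> {}" by blast
  moreover have "continuous_on S q"
    unfolding q_def by (intro continuous_intros continuous_on_subset[OF continuous_on_product_coordinates]) auto
  ultimately obtain x where xS: "x \<in> S" and max: "\<And>y. y \<in> S \<Longrightarrow> q y \<le> q x"
    using continuous_attains_sup[of S q] by blast
  define l where "l = q x"
  have le: "q y \<le> l * nn y" for y
  proof (cases "nn y = 0")
    case True
    then have "y i = 0" if "i < n" for i
      using that by (simp add: nn_def sum_nonneg_eq_0_iff)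
    then show ?thesis using True by (simp add: q_def)
  next
    case False
    then have pos: "nn y > 0"
      by (simp add: nn_def order_less_le sum_nonneg)
    define r where "r = 1 / sqrt (nn y)"
    have r2: "r * r = 1 / nn y" using pos by (simp add: r_def)
    \<comment> \<open>Besides normalising, \<open>z\<close> truncates \<open>y\<close>, because
      members of \<open>S\<close> vanish from \<open>n\<close> on; \<open>q\<close> and
      \<open>nn\<close> see only the coordinates below \<open>n\<close>.\<close>
    define z where "z = (\<lambda>i. if i < n then r * y i else 0)"
    have "nn z = r * r * nn y"
      by (simp add: nn_def z_def sum_distrib_left power2_eq_square mult_ac)
    then have "z \<in> S" using r2 pos by (auto simp: S_def nn_def z_def)
    moreover have "q z = r * r * q y"
      by (simp add: q_def z_def sum_distrib_left mult_ac)
    ultimately have "q y / nn y \<le> l" using max[of z] r2 by (simp add: l_def)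
    with pos show ?thesis by (simp add: divide_simps)
  qed
  \<comment> \<open>The function \<open>l * nn y - q y\<close> is nonnegative and vanishes at
    \<open>x\<close>, where its gradient is twice the residual \<open>g\<close>. Moving from
    \<open>x\<close> along \<open>g\<close> gives a quadratic in \<open>t\<close> with linear
    coefficient \<open>2 * nn g\<close>, which must therefore be zero.\<close>
  define g where "g = (\<lambda>i. l * x i - (\<Sum>j<n. a i j * x j))"
  have nx: "nn x = 1" using xS by (simp add: S_def nn_def)
  have "2 * t * nn g + t\<^sup>2 * (l * nn g - q g) \<ge> 0" for t
  proof -
    have nnt: "nn (\<lambda>i. x i + t * g i) = nn x + 2 * t * (\<Sum>i<n. g i * x i) + t\<^sup>2 * nn g"
      by (simp add: nn_def sum_distrib_left power2_eq_square algebra_simps sum.distrib)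
    \<comment> \<open>Symmetry of \<open>a\<close> makes the two cross terms of the expansion
      equal.\<close>
    have swap: "(\<Sum>i<n. \<Sum>j<n. a i j * x i * g j) = (\<Sum>i<n. \<Sum>j<n. a i j * g i * x j)"
      by (subst sum.swap) (intro sum.cong refl, simp add: sym mult_ac)
    have "q (\<lambda>i. x i + t * g i) = q x + t * (\<Sum>i<n. \<Sum>j<n. a i j * x i * g j)
        + t * (\<Sum>i<n. \<Sum>j<n. a i j * g i * x j) + t\<^sup>2 * q g"
      by (simp add: q_def sum_distrib_left power2_eq_square algebra_simps sum.distrib)
    then have qt: "q (\<lambda>i. x i + t * g i)
        = q x + 2 * t * (\<Sum>i<n. \<Sum>j<n. a i j * g i * x j) + t\<^sup>2 * q g"
      by (simp add: swap)
    have ng: "nn g = l * (\<Sum>i<n. g i * x i) - (\<Sum>i<n. \<Sum>j<n. a i j * g i * x j)"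
    proof -
      have "nn g = (\<Sum>i<n. g i * (l * x i - (\<Sum>j<n. a i j * x j)))"
        unfolding nn_def power2_eq_square by (simp add: g_def)
      then show ?thesis
        by (simp add: right_diff_distrib sum_subtractf sum_distrib_left mult_ac)
    qed
    show ?thesis
      using le[of "\<lambda>i. x i + t * g i"] unfolding nnt qt nx
      by (simp add: ng l_def algebra_simps)
  qed
  then have "nn g = 0" by (rule linear_coeff_zero_if_quadratic_nonneg)
  then have "g i = 0" if "i < n" for i
    using that by (simp add: nn_def sum_nonneg_eq_0_iff)
  then have ev: "(\<Sum>j<n. a i j * x j) = l * x i" if "i < n" for i
    using that by (simp add: g_def)
  obtain i where "i < n" "x i \<noteq> 0"
    using nx by (force simp: nn_def intro: ccontr)
  then show thesis
    using that[OF _ _ ev] le by (simp add: q_def nn_def)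
qed

text \<open>The eigenvalue \<open>l\<close> of the maximising vector lies in the finite spectrum, so
  it is at most \<open>lambda1 M\<close>; as a sum of squares is nonnegative, the bound passes from
  \<open>l\<close> to \<open>lambda1 M\<close>.\<close>

lemma rayleigh_le_lambda1:
  assumes M: "M \<in> carrier_mat n n" and sym: "transpose_mat M = M" and n: "n > 0"
  shows "(\<Sum>i<n. \<Sum>j<n. M $$ (i, j) * y i * y j) \<le> lambda1 M * (\<Sum>i<n. (y i)\<^sup>2)"
proof -
  have symM: "M $$ (i, j) = M $$ (j, i)" if "i < n" "j < n" for i j
    using that M sym by (metis carrier_matD index_transpose_mat(1))
  obtain l x i where i: "i < n" "x i \<noteq> 0"
    and ev: "\<And>i. i < n \<Longrightarrow> (\<Sum>j<n. M $$ (i, j) * x j) = l * x i"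
    and le: "\<And>y. (\<Sum>i<n. \<Sum>j<n. M $$ (i, j) * y i * y j) \<le> l * (\<Sum>i<n. (y i)\<^sup>2)"
    by (rule quadratic_form_maximum_eigenvector[of n "\<lambda>i j. M $$ (i, j)", OF n symM]) blast+
  have "vec n x \<noteq> 0\<^sub>v n"
    using i by (metis index_vec index_zero_vec(1))
  moreover have "M *\<^sub>v vec n x = l \<cdot>\<^sub>v vec n x"
    using M ev by (intro eq_vecI) (auto simp: scalar_prod_def atLeast0LessThan)
  ultimately have "l \<in> spectrum M"
    using M by (auto simp: spectrum_def eigenvalue_def eigenvector_def intro!: exI[of _ "vec n x"])
  then have "l \<le> lambda1 M"
    unfolding lambda1_def using card_finite_spectrum(1)[OF M] by (rule Max_ge[rotated])
  then have "l * (\<Sum>i<n. (y i)\<^sup>2) \<le> lambda1 M * (\<Sum>i<n. (y i)\<^sup>2)"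
    by (intro mult_right_mono sum_nonneg) auto
  with le show ?thesis by (rule order_trans)
qed

section \<open>Entry sums of submatrices\<close>

lemma bij_betw_pick:
  assumes "finite I"
  shows "bij_betw (pick I) {0..<card I} I"
\<comment> \<open>The position of \<open>i\<close> in the increasing enumeration of
  \<open>I\<close>, counted from 0, is the number of smaller elements.\<close>
proof (rule bij_betw_byWitness[where f' = "\<lambda>i. card {a \<in> I. a < i}"])
  show "(\<lambda>i. card {a \<in> I. a < i}) ` I \<subseteq> {0..<card I}"
    using assms by (auto intro!: psubset_card_mono)
qed (auto simp: card_pick pick_card_in_set pick_in_set_le)

lemma sum_mat_submatrix:
  assumes "I \<subseteq> {0..<dim_row A}" and "J \<subseteq> {0..<dim_col A}"
  shows "sum_mat (submatrix A I J) = (\<Sum>i\<in>I. \<Sum>j\<in>J. A $$ (i, j))"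
proof -
  have fin: "finite I" "finite J"
    using assms by (auto intro: finite_subset)
  \<comment> \<open>The dimensions of a submatrix count only indices in range; here all of
    \<open>I\<close> and \<open>J\<close> is in range.\<close>
  have I: "{i. i < dim_row A \<and> i \<in> I} = I" and J: "{j. j < dim_col A \<and> j \<in> J} = J"
    using assms by auto
  have "sum_mat (submatrix A I J)
      = (\<Sum>i\<in>{0..<card I}. \<Sum>j\<in>{0..<card J}. A $$ (pick I i, pick J j))"
    unfolding sum_mat_def dim_submatrix I J sum.cartesian_product
    by (intro sum.cong refl) (auto simp: submatrix_index I J)
  also have "\<dots> = (\<Sum>i\<in>I. \<Sum>j\<in>{0..<card J}. A $$ (i, pick J j))"
    by (rule sum.reindex_bij_betw[OF bij_betw_pick[OF fin(1)],
          where g = "\<lambda>i. \<Sum>j\<in>{0..<card J}. A $$ (i, pick J j)"])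
  also have "\<dots> = (\<Sum>i\<in>I. \<Sum>j\<in>J. A $$ (i, j))"
    by (intro sum.cong refl sum.reindex_bij_betw[OF bij_betw_pick[OF fin(2)]])
  finally show ?thesis .
qed

section \<open>Sums over the test vectors of a partition\<close>

lemma sum_partition_indicator:
  fixes n :: nat
  assumes P: "partition_on {0..<n} \<V>" and i: "i < n"
  shows "(\<Sum>V\<in>\<V>. indicator V i :: real) = 1"
proof -
  have fin: "finite \<V>" using P by (rule finite_elements[rotated]) simp
  obtain W where W: "W \<in> \<V>" "i \<in> W"
    using partition_onD1[OF P] i by (metis UnionE atLeastLessThan_iff le0)
  have "(\<Sum>V\<in>\<V>. indicator V i :: real) = (\<Sum>V\<in>\<V>. if V = W then 1 else 0)"
    using partition_onD2[OF P] W
    by (intro sum.cong refl) (auto simp: indicator_def disjoint_def)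
  also have "\<dots> = 1" using fin W by simp
  finally show ?thesis .
qed

text \<open>The sum on the right is 1 if \<open>i\<close> and \<open>j\<close> share a class and 0
  otherwise. It stays in indicator form so that, weighted with matrix entries, it turns into the
  diagonal block sums.\<close>

lemma sum_test_vector_products:
  fixes n :: nat
  assumes P: "partition_on {0..<n} \<V>" and i: "i < n" and j: "j < n"
  defines "k \<equiv> real (card \<V>)"
  shows "(\<Sum>V\<in>\<V>. (1 - k * indicator V i) * (1 - k * indicator V j))
    = k\<^sup>2 * (\<Sum>V\<in>\<V>. indicator V i * indicator V j) - k"
proof -
  have "(\<Sum>V\<in>\<V>. (1 - k * indicator V i) * (1 - k * indicator V j))
    = (\<Sum>V\<in>\<V>. 1 - k * indicator V i - k * indicator V j
        + k\<^sup>2 * (indicator V i * indicator V j))"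
    by (simp add: algebra_simps power2_eq_square)
  also have "\<dots> = k - k * (\<Sum>V\<in>\<V>. indicator V i) - k * (\<Sum>V\<in>\<V>. indicator V j)
      + k\<^sup>2 * (\<Sum>V\<in>\<V>. indicator V i * indicator V j)"
    by (simp add: sum.distrib sum_subtractf sum_distrib_left k_def)
  finally show ?thesis
    by (simp add: sum_partition_indicator[OF P i] sum_partition_indicator[OF P j])
qed

text \<open>Moving the sum over classes innermost gives every entry the weight \<open>- k\<close>,
  and an additional \<open>k\<^sup>2\<close> if it lies in a diagonal block.\<close>

lemma sum_test_vector_forms:
  assumes M: "M \<in> carrier_mat n n" and P: "partition_on {0..<n} \<V>"
  defines "k \<equiv> real (card \<V>)"
  shows "(\<Sum>V\<in>\<V>. \<Sum>i<n. \<Sum>j<n. M $$ (i, j) * (1 - k * indicator V i) * (1 - k * indicator V j))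
    = k\<^sup>2 * (\<Sum>V\<in>\<V>. sum_mat (submatrix M V V)) - k * sum_mat M"
proof -
  have blk: "(\<Sum>i<n. \<Sum>j<n. M $$ (i, j) * (indicator V i * indicator V j))
      = sum_mat (submatrix M V V)" if "V \<in> \<V>" for V
  proof -
    have V: "V \<subseteq> {0..<n}" using partition_onD1[OF P] that by auto
    then have eq: "{..<n} \<inter> V = V" by auto
    have "(\<Sum>i<n. \<Sum>j<n. M $$ (i, j) * (indicator V i * indicator V j))
        = (\<Sum>i<n. indicator V i * (\<Sum>j<n. indicator V j * M $$ (i, j)))"
      unfolding sum_distrib_left by (simp add: mult_ac)
    also have "\<dots> = (\<Sum>i\<in>V. \<Sum>j\<in>V. M $$ (i, j))"
      by (simp only: sum_indicator_mult[OF finite_lessThan] eq)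
    finally show ?thesis using V M by (simp add: sum_mat_submatrix)
  qed
  have "(\<Sum>V\<in>\<V>. \<Sum>i<n. \<Sum>j<n. M $$ (i, j) * (1 - k * indicator V i) * (1 - k * indicator V j))
    = (\<Sum>i<n. \<Sum>j<n. M $$ (i, j) * (\<Sum>V\<in>\<V>. (1 - k * indicator V i) * (1 - k * indicator V j)))"
    by (subst sum.swap, rule sum.cong[OF refl], subst sum.swap)
      (simp add: sum_distrib_left mult.assoc)
  also have "\<dots> = (\<Sum>i<n. \<Sum>j<n. M $$ (i, j) * (k\<^sup>2 * (\<Sum>V\<in>\<V>. indicator V i * indicator V j) - k))"
    by (simp add: sum_test_vector_products[OF P] k_def)
  also have "\<dots> = k\<^sup>2 * (\<Sum>i<n. \<Sum>j<n. \<Sum>V\<in>\<V>. M $$ (i, j) * (indicator V i * indicator V j))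
      - k * (\<Sum>i<n. \<Sum>j<n. M $$ (i, j))"
    by (simp add: right_diff_distrib sum_subtractf sum_distrib_left mult_ac)
  also have "(\<Sum>i<n. \<Sum>j<n. \<Sum>V\<in>\<V>. M $$ (i, j) * (indicator V i * indicator V j))
      = (\<Sum>V\<in>\<V>. \<Sum>i<n. \<Sum>j<n. M $$ (i, j) * (indicator V i * indicator V j))"
    by (subst (2) sum.swap, subst sum.swap) simp
  also have "(\<Sum>i<n. \<Sum>j<n. M $$ (i, j)) = sum_mat M"
    using M by (simp add: sum_mat_def sum.cartesian_product atLeast0LessThan)
  finally show ?thesis by (simp add: blk)
qed

text \<open>This is the case \<open>i = j\<close> of the product identity: each of the
  \<open>n\<close> coordinates contributes \<open>k\<^sup>2 - k\<close>.\<close>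

lemma sum_test_vector_norms:
  fixes n :: nat
  assumes P: "partition_on {0..<n} \<V>"
  defines "k \<equiv> real (card \<V>)"
  shows "(\<Sum>V\<in>\<V>. \<Sum>i<n. (1 - k * indicator V i)\<^sup>2) = k * (k - 1) * real n"
proof -
  have "(\<Sum>V\<in>\<V>. (1 - k * indicator V i)\<^sup>2) = k * (k - 1)" if "i < n" for i
  proof -
    have "(\<Sum>V\<in>\<V>. (1 - k * indicator V i)\<^sup>2)
        = k\<^sup>2 * (\<Sum>V\<in>\<V>. indicator V i * indicator V i) - k"
      unfolding power2_eq_square[of "1 - _"] k_def
      by (rule sum_test_vector_products[OF P that that])
    also have "(\<Sum>V\<in>\<V>. indicator V i * indicator V i :: real) = 1"
      using sum_partition_indicator[OF P that] by (simp flip: indicator_inter_arith)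
    finally show ?thesis by (simp add: algebra_simps power2_eq_square)
  qed
  then show ?thesis by (subst sum.swap) simp
qed

section \<open>Block sums of diagonal matrices and of differences\<close>

lemma sum_mat_diagonal_blocks:
  assumes B: "B \<in> carrier_mat n n" "diagonal_mat B" and P: "partition_on {0..<n} \<V>"
  shows "(\<Sum>V\<in>\<V>. sum_mat (submatrix B V V)) = (sum_mat B :: real)"
proof -
  \<comment> \<open>Each block sum is a partial trace. This is used for the classes and again for
    the whole index set, where the partial traces add up to the full one.\<close>
  have diag: "(\<Sum>i\<in>V. \<Sum>j\<in>V. B $$ (i, j)) = (\<Sum>i\<in>V. B $$ (i, i))" if "V \<subseteq> {0..<n}" for V
  proof (rule sum.cong[OF refl])
    fix i assume i: "i \<in> V"
    have "(\<Sum>j\<in>V. B $$ (i, j)) = (\<Sum>j\<in>V. if j = i then B $$ (i, i) else 0)"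
      using B that i by (intro sum.cong refl) (auto simp: diagonal_mat_def subset_iff)
    also have "\<dots> = B $$ (i, i)" using i that finite_subset[OF that] by simp
    finally show "(\<Sum>j\<in>V. B $$ (i, j)) = B $$ (i, i)" .
  qed
  have sub: "V \<subseteq> {0..<n}" if "V \<in> \<V>" for V using partition_onD1[OF P] that by auto
  have "(\<Sum>V\<in>\<V>. sum_mat (submatrix B V V)) = (\<Sum>V\<in>\<V>. \<Sum>i\<in>V. B $$ (i, i))"
    using B sub by (simp add: sum_mat_submatrix diag)
  also have "\<dots> = (\<Sum>i\<in>\<Union>\<V>. B $$ (i, i))"
    using partition_onD2[OF P] sub finite_subset[OF sub]
    by (subst sum.Union_disjoint) (auto simp: disjoint_def)
  also have "\<dots> = (\<Sum>i\<in>{0..<n}. \<Sum>j\<in>{0..<n}. B $$ (i, j))"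
    using partition_onD1[OF P] by (simp add: diag)
  finally show ?thesis using B by (simp add: sum_mat_def sum.cartesian_product)
qed

lemma sum_mat_submatrix_minus:
  fixes A B :: "real mat"
  assumes "A \<in> carrier_mat n n" "B \<in> carrier_mat n n" "V \<subseteq> {0..<n}"
  shows "sum_mat (submatrix (B - A) V V) = sum_mat (submatrix B V V) - sum_mat (submatrix A V V)"
proof -
  have "(B - A) $$ (i, j) = B $$ (i, j) - A $$ (i, j)" if "i \<in> V" "j \<in> V" for i j
    using assms that by (subst index_minus_mat) auto
  then show ?thesis
    using assms by (simp add: sum_mat_submatrix sum_subtractf)
qed

section \<open>The cut bound from the summed Rayleigh inequalities\<close>

theorem theorem3p1:
  fixes A B :: "real mat" and n k :: nat and \<V> :: "nat set set"
  assumes "A \<in> carrier_mat n n" and "transpose_mat A = A"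
    and "k \<ge> 2"
    and "partition_on {0..<n} \<V>" and "card \<V> = k"
    and "B \<in> carrier_mat n n" and "diagonal_mat B"
  shows "lambda1 (B - A) \<ge>
    2 * real k / ((real k - 1) * real n) * mat_cut A \<V>
      - 1 / real n * sum_mat A + 1 / real n * sum_mat B"
proof -
  note A = assms(1) and P = assms(4) and B = assms(6)
  \<comment> \<open>For \<open>n = 0\<close> the only partition is empty, against
    \<open>k \<ge> 2\<close>.\<close>
  have n: "n > 0"
  proof (rule ccontr)
    assume "\<not> n > 0"
    then have "\<V> = {}" using P by (simp add: partition_on_empty)
    with assms(3,5) show False by simp
  qed
  have M: "B - A \<in> carrier_mat n n" using A by (rule minus_carrier_mat)
  have "transpose_mat B = B"
    using B assms(7) by (intro eq_matI) (auto simp: diagonal_mat_def, metis)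
  then have sym: "transpose_mat (B - A) = B - A"
    using A B assms(2) by (simp add: transpose_minus)
  define SA where "SA = (\<Sum>V\<in>\<V>. sum_mat (submatrix A V V))"
  have blocks: "(\<Sum>V\<in>\<V>. sum_mat (submatrix (B - A) V V)) = sum_mat B - SA"
  proof -
    have "(\<Sum>V\<in>\<V>. sum_mat (submatrix (B - A) V V))
        = (\<Sum>V\<in>\<V>. sum_mat (submatrix B V V) - sum_mat (submatrix A V V))"
      using partition_onD1[OF P] by (intro sum.cong refl sum_mat_submatrix_minus[OF A B]) auto
    then show ?thesis
      by (simp add: sum_subtractf SA_def sum_mat_diagonal_blocks[OF B assms(7) P])
  qed
  have total: "sum_mat (B - A) = sum_mat B - sum_mat A"
    using A B unfolding sum_mat_def
    by (simp flip: sum_subtractf) (auto intro!: sum.cong)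
  let ?x = "\<lambda>V i. 1 - real k * indicator V i"
  have "(\<Sum>V\<in>\<V>. \<Sum>i<n. \<Sum>j<n. (B - A) $$ (i, j) * ?x V i * ?x V j)
      \<le> (\<Sum>V\<in>\<V>. lambda1 (B - A) * (\<Sum>i<n. (?x V i)\<^sup>2))"
    by (intro sum_mono rayleigh_le_lambda1 M sym n)
  then have "(real k)\<^sup>2 * (sum_mat B - SA) - real k * (sum_mat B - sum_mat A)
      \<le> lambda1 (B - A) * (real k * (real k - 1) * real n)"
    using sum_test_vector_forms[OF M P] sum_test_vector_norms[OF P]
    by (simp add: assms(5) blocks total flip: sum_distrib_left)
  \<comment> \<open>A common factor \<open>k > 0\<close> is split off on both sides for
    cancelling.\<close>
  then have "real k * (real k * (sum_mat B - SA) - (sum_mat B - sum_mat A))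
      \<le> real k * (lambda1 (B - A) * ((real k - 1) * real n))"
    by (simp add: algebra_simps power2_eq_square)
  then have *: "real k * (sum_mat B - SA) - (sum_mat B - sum_mat A)
      \<le> lambda1 (B - A) * ((real k - 1) * real n)"
    using assms(3) by simp
  \<comment> \<open>With \<open>2 * mat_cut A \<V> = sum_mat A - SA\<close>, the numerator is
    \<open>k * (sum_mat A - SA) - (k - 1) * sum_mat A + (k - 1) * sum_mat B\<close>.\<close>
  have "2 * real k / ((real k - 1) * real n) * mat_cut A \<V>
      - 1 / real n * sum_mat A + 1 / real n * sum_mat B
    = (real k * (sum_mat B - SA) - (sum_mat B - sum_mat A)) / ((real k - 1) * real n)"
    using assms(3) n by (simp add: mat_cut_def SA_def divide_simps) (simp add: algebra_simps)
  also have "\<dots> \<le> lambda1 (B - A)"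
    using * assms(3) n by (subst pos_divide_le_eq) auto
  finally show ?thesis .
qed

end
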